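(* Let $T:X\to X$ be a non-singular measurable transformation and $u:X\to\mathbb C$ a measurable function, not a.e. zero, such that $W_{u,T}$ is a bounded operator on $L(p,q)$. Suppose there is a sequence $\langle A_k\rangle_{k=0}^\infty$ of measurable sets such that for every $k\ge 0$: (a) $0<\mu(A_k)<\infty$; (b) $\mu(N_k\cap T^{-k}(A_k))\neq 0$; (c) $\mu(N_{k+1}\cap T^{-(k+1)}(A_k))=0$. Then $\alpha(W_{u,T})=\infty$.
   Context: $(X,\mathcal A,\mu)$ is a $\sigma$-finite complete measure space. For measurable $h:X\to\mathbb C$ put $\mu_h(s)=\mu(\{x\in X:|h(x)|>s\})$ for $s\ge 0$, $h^*(t)=\inf\{s>0:\mu_h(s)\le t\}$ and $h^{**}(t)=\frac1t\int_0^t h^*(s)\,ds$ for $t>0$. The Lorentz space $L(p,q)$ (for $1<p<\infty$, $1\le q<\infty$, or $1<p\le\infty$, $q=\infty$) is the Banach space of (a.e.-equivalence classes of) measurable $h:X\to\mathbb C$ with $\|h\|_{pq}<\infty$, where $\|h\|_{pq}=\left(\frac qp\int_0^\infty (t^{1/p}h^{**}(t))^q\frac{dt}{t}\right)^{1/q}$ if $1<p<\infty$, $1\le q<\infty$, and $\|h\|_{pq}=\sup_{t>0}t^{1/p}h^{**}(t)$ if $1<p\le\infty$, $q=\infty$. A measurable transformation $T:X\to X$ is non-singular if $\mu(A)=0$ implies $\mu(T^{-1}(A))=0$. $W_{u,T}f=(u\circ T)\cdot(f\circ T)$. $N_0=X$ and $N_k=\{x\in X: u(T^i(x))\neq 0\text{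 for all }1\le i\le k\}$ for $k\ge 1$. For a bounded operator $L$ with null space $\mathcal N(L)$, the ascent is $\alpha(L)=\inf\{k\in\mathbb N\cup\{0\}:\mathcal N(L^{k+1})=\mathcal N(L^k)\}$ (equal to $\infty$ if no such $k$ exists). *)

theory Defs
  imports "HOL-Analysis.Analysis"
begin

section \<open>Lorentz spaces\<close>

text \<open>
  All quantities below live in \<^typ>\<open>ennreal\<close>, so that infima over the empty set and divergent
  integrals are \<open>\<infinity>\<close>. The power is only used with exponents \<open>r > 0\<close>.
\<close>

definition enn_powr :: "ennreal \<Rightarrow> real \<Rightarrow> ennreal" where
  "enn_powr x r = (if x = \<infinity> then \<infinity> else ennreal (enn2real x powr r))"

definition distr_fun :: "'a measure \<Rightarrow> ('a \<Rightarrow> complex) \<Rightarrow> real \<Rightarrow> ennreal" where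
  "distr_fun M h s = emeasure M {x \<in> space M. cmod (h x) > s}"

definition decr_rearr :: "'a measure \<Rightarrow> ('a \<Rightarrow> complex) \<Rightarrow> real \<Rightarrow> ennreal" where
  "decr_rearr M h t = Inf {ennreal s | s. s > 0 \<and> distr_fun M h s \<le> ennreal t}"

definition max_rearr :: "'a measure \<Rightarrow> ('a \<Rightarrow> complex) \<Rightarrow> real \<Rightarrow> ennreal" where
  "max_rearr M h t = ennreal (1 / t) * (\<integral>\<^sup>+ s \<in> {0<..<t}. decr_rearr M h s \<partial>lborel)"

text \<open>Here \<open>enn2real (1 / p)\<close> is the real number \<open>1/p\<close>, which is \<open>0\<close> for \<open>p = \<infinity>\<close>.\<close>

definition lorentz_norm :: "'a measure \<Rightarrow> ennreal \<Rightarrow> ennreal \<Rightarrow> ('a \<Rightarrow> complex) \<Rightarrow> ennreal" where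
  "lorentz_norm M p q h =
     (if q = \<infinity>
      then (SUP t \<in> {0<..}. ennreal (t powr enn2real (1 / p)) * max_rearr M h t)
      else enn_powr
             (q / p * (\<integral>\<^sup>+ t \<in> {0<..}.
                enn_powr (ennreal (t powr enn2real (1 / p)) * max_rearr M h t) (enn2real q)
                  * ennreal (1 / t) \<partial>lborel))
             (enn2real (1 / q)))"

definition lorentz_fun :: "'a measure \<Rightarrow> ennreal \<Rightarrow> ennreal \<Rightarrow> ('a \<Rightarrow> complex) set" where
  "lorentz_fun M p q = {h \<in> borel_measurable M. lorentz_norm M p q h < \<infinity>}"

definition lorentz_rel ::
    "'a measure \<Rightarrow> ennreal \<Rightarrow> ennreal \<Rightarrow> (('a \<Rightarrow> complex) \<times> ('a \<Rightarrow> complex)) set" where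
  "lorentz_rel M p q =
     {(f, g). f \<in> lorentz_fun M p q \<and> g \<in> lorentz_fun M p q \<and> (AE x in M. f x = g x)}"

definition lorentz_class ::
    "'a measure \<Rightarrow> ennreal \<Rightarrow> ennreal \<Rightarrow> ('a \<Rightarrow> complex) \<Rightarrow> ('a \<Rightarrow> complex) set" where
  "lorentz_class M p q f = lorentz_rel M p q `` {f}"

definition lorentz_space ::
    "'a measure \<Rightarrow> ennreal \<Rightarrow> ennreal \<Rightarrow> ('a \<Rightarrow> complex) set set" where
  "lorentz_space M p q = lorentz_fun M p q // lorentz_rel M p q"

lemma equiv_lorentz_rel: "equiv (lorentz_fun M p q) (lorentz_rel M p q)"
proof (rule equivI)
  show "lorentz_rel M p q \<subseteq> lorentz_fun M p q \<times> lorentz_fun M p q"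
    by (auto simp: lorentz_rel_def)
  show "refl_on (lorentz_fun M p q) (lorentz_rel M p q)"
    by (auto simp: refl_on_def lorentz_rel_def)
  show "sym (lorentz_rel M p q)"
    by (auto simp: sym_def lorentz_rel_def)
  show "trans (lorentz_rel M p q)"
    unfolding trans_def lorentz_rel_def by (auto elim: AE_mp)
qed


section \<open>Operators on Lorentz spaces\<close>

text \<open>
  A map \<open>L\<close> on functions is a bounded operator on \<open>L(p,q)\<close> if it induces a bounded linear map on
  a.e.-classes. Finiteness of \<open>\<parallel>L f\<parallel>\<close>, together with measurability of \<open>L f\<close>, is the requirement
  \<open>L f \<in> lorentz_fun M p q\<close>.
\<close>

definition lorentz_bounded_op ::
    "'a measure \<Rightarrow> ennreal \<Rightarrow> ennreal \<Rightarrow> (('a \<Rightarrow> complex) \<Rightarrow> ('a \<Rightarrow> complex)) \<Rightarrow> bool" where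
  "lorentz_bounded_op M p q L \<longleftrightarrow>
     (\<forall>f \<in> lorentz_fun M p q. L f \<in> lorentz_fun M p q) \<and>
     (\<forall>(f, g) \<in> lorentz_rel M p q. (L f, L g) \<in> lorentz_rel M p q) \<and>
     (\<forall>f \<in> lorentz_fun M p q. \<forall>g \<in> lorentz_fun M p q.
        AE x in M. L (\<lambda>y. f y + g y) x = L f x + L g x) \<and>
     (\<forall>c. \<forall>f \<in> lorentz_fun M p q. AE x in M. L (\<lambda>y. c * f y) x = c * L f x) \<and>
     (\<exists>C::real. \<forall>f \<in> lorentz_fun M p q.
        lorentz_norm M p q (L f) \<le> ennreal C * lorentz_norm M p q f)"

definition lorentz_lift ::
    "'a measure \<Rightarrow> ennreal \<Rightarrow> ennreal \<Rightarrow> (('a \<Rightarrow> complex) \<Rightarrow> ('a \<Rightarrow> complex))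
      \<Rightarrow> ('a \<Rightarrow> complex) set \<Rightarrow> ('a \<Rightarrow> complex) set" where
  "lorentz_lift M p q L F = (\<Union>f \<in> F. lorentz_class M p q (L f))"

lemma lorentz_lift_class:
  assumes "lorentz_bounded_op M p q L" and "f \<in> lorentz_fun M p q"
  shows "lorentz_lift M p q L (lorentz_class M p q f) = lorentz_class M p q (L f)"
proof -
  have "lorentz_class M p q (L g) = lorentz_class M p q (L f)"
    if "g \<in> lorentz_class M p q f" for g
  proof -
    have "(L f, L g) \<in> lorentz_rel M p q"
      using assms(1) that by (auto simp: lorentz_bounded_op_def lorentz_class_def)
    then show ?thesis
      unfolding lorentz_class_def using equiv_class_eq[OF equiv_lorentz_rel] by blast
  qed
  moreover have "f \<in> lorentz_class M p q f"
    using assms(2) by (simp add: lorentz_class_def lorentz_rel_def)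
  ultimately show ?thesis
    unfolding lorentz_lift_def by blast
qed

definition weighted_comp ::
    "('a \<Rightarrow> complex) \<Rightarrow> ('a \<Rightarrow> 'a) \<Rightarrow> ('a \<Rightarrow> complex) \<Rightarrow> ('a \<Rightarrow> complex)" where
  "weighted_comp u T f = (\<lambda>x. u (T x) * f (T x))"

definition nonsingular :: "'a measure \<Rightarrow> ('a \<Rightarrow> 'a) \<Rightarrow> bool" where
  "nonsingular M T \<longleftrightarrow>
     (\<forall>A \<in> sets M. emeasure M A = 0 \<longrightarrow> emeasure M (T -` A \<inter> space M) = 0)"

definition nonvanishing_set :: "'a measure \<Rightarrow> ('a \<Rightarrow> complex) \<Rightarrow> ('a \<Rightarrow> 'a) \<Rightarrow> nat \<Rightarrow> 'a set" where
  "nonvanishing_set M u T k = {x \<in> space M. \<forall>i \<in> {1..k}. u ((T ^^ i) x) \<noteq> 0}"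


section \<open>Ascent\<close>

text \<open>
  For an operator \<open>L\<close> on the space with carrier \<open>V\<close> and zero vector \<open>z\<close>. In \<^typ>\<open>enat\<close> the infimum
  of the empty set is \<open>\<infinity>\<close>.
\<close>

definition null_space :: "'v set \<Rightarrow> 'v \<Rightarrow> ('v \<Rightarrow> 'v) \<Rightarrow> 'v set" where
  "null_space V z L = {v \<in> V. L v = z}"

definition ascent :: "'v set \<Rightarrow> 'v \<Rightarrow> ('v \<Rightarrow> 'v) \<Rightarrow> enat" where
  "ascent V z L = Inf {enat k | k. null_space V z (L ^^ (k + 1)) = null_space V z (L ^^ k)}"

text \<open>The ascent of the operator on \<open>L(p,q)\<close> (on classes) induced by \<open>L\<close>.\<close>

definition lorentz_ascent ::
    "'a measure \<Rightarrow> ennreal \<Rightarrow> ennreal \<Rightarrow> (('a \<Rightarrow> complex) \<Rightarrow> ('a \<Rightarrow> complex)) \<Rightarrow> enat" where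
  "lorentz_ascent M p q L =
     ascent (lorentz_space M p q) (lorentz_class M p q (\<lambda>_. 0)) (lorentz_lift M p q L)"

end

theory Submission
  imports Defs
begin

text \<open>
  The \<open>k\<close>-th power of \<open>W\<close> is \<open>f \<mapsto> (\<Prod>i=1..k. u \<circ> T^i) \<cdot> (f \<circ> T^k)\<close>, so the support of \<open>W^k\<close> applied
  to the indicator of \<open>A\<close> is \<open>N_k \<inter> T^{-k}(A)\<close>. The indicator of \<open>A_k\<close> lies in \<open>L(p,q)\<close>, because
  \<open>A_k\<close> has finite measure, and it witnesses that the null spaces of \<open>W^k\<close> and \<open>W^(k+1)\<close> differ.
\<close>

section \<open>Powers in \<open>ennreal\<close> and the zero function\<close>

lemma enn_powr_mono: "x \<le> y \<Longrightarrow> 0 \<le> r \<Longrightarrow> enn_powr x r \<le> enn_powr y r"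
  unfolding enn_powr_def
  by (auto simp: top_unique less_top intro!: ennreal_leI powr_mono2 enn2real_mono)

lemma enn_powr_finite: "x < \<infinity> \<Longrightarrow> enn_powr x r < \<infinity>"
  by (auto simp: enn_powr_def)

text \<open>The infimum runs over strictly positive heights only, so 0 is not itself a candidate.
  Every \<open>e > 0\<close> is one, and letting \<open>e\<close> tend to 0 gives the value.\<close>

lemma decr_rearr_zero: "decr_rearr M (\<lambda>_. 0) t = 0"
proof -
  have "decr_rearr M (\<lambda>_. 0) t \<le> ennreal e" if "e > 0" for e
    unfolding decr_rearr_def using that by (intro Inf_lower) (auto simp: distr_fun_def)
  then have "decr_rearr M (\<lambda>_. 0) t \<le> 0"
    by (auto intro: ennreal_le_epsilon[where y = 0, simplified])
  then show ?thesis by simp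
qed

lemma zero_in_lorentz_fun: "(\<lambda>_. 0) \<in> lorentz_fun M p q"
proof -
  have "max_rearr M (\<lambda>_. 0) t = 0" for t
    by (simp add: max_rearr_def decr_rearr_zero)
  then show ?thesis
    by (simp add: lorentz_fun_def lorentz_norm_def enn_powr_def image_constant_conv)
qed

section \<open>Indicators of sets of finite measure belong to the Lorentz space\<close>

lemma distr_fun_indicator_le:
  assumes "A \<in> sets M" "0 < s"
  shows "distr_fun M (indicator A) s \<le> (if s < 1 then emeasure M A else 0)"
proof -
  have "{x \<in> space M. cmod (indicator A x) > s} \<subseteq> (if s < 1 then A else {})"
    using assms by (auto simp: indicator_def split: if_splits)
  then have "distr_fun M (indicator A) s \<le> emeasure M (if s < 1 then A else {})"
    unfolding distr_fun_def using assms by (intro emeasure_mono) auto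
  then show ?thesis by (auto split: if_splits)
qed

text \<open>Height 1 is always admissible in the infimum, because an indicator never exceeds 1
  strictly.\<close>

lemma decr_rearr_indicator_le_1:
  assumes "A \<in> sets M"
  shows "decr_rearr M (indicator A) t \<le> 1"
  unfolding decr_rearr_def
  using distr_fun_indicator_le[OF assms, of 1] by (intro Inf_lower CollectI exI[of _ 1]) auto

text \<open>Once \<open>t\<close> reaches the measure of \<open>A\<close>, every positive height is
  admissible.\<close>

lemma decr_rearr_indicator_eq_0:
  assumes "A \<in> sets M" "emeasure M A \<le> ennreal t"
  shows "decr_rearr M (indicator A) t = 0"
proof -
  have "decr_rearr M (indicator A) t \<le> ennreal e" if "e > 0" for e
  proof -
    have "distr_fun M (indicator A) e \<le> ennreal t"
      using distr_fun_indicator_le[OF assms(1) that] assms(2) by (auto split: if_splits)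
    then show ?thesis
      unfolding decr_rearr_def using that by (intro Inf_lower) auto
  qed
  then have "decr_rearr M (indicator A) t \<le> 0"
    by (auto intro: ennreal_le_epsilon[where y = 0, simplified])
  then show ?thesis by simp
qed

text \<open>The rearrangement is at most 1 and vanishes from \<open>m\<close> on, so its integral
  over \<open>{0<..<t}\<close> is at most both \<open>t\<close> and \<open>m\<close>. Dividing by
  \<open>t\<close> gives the minimum.\<close>

lemma max_rearr_indicator_le:
  assumes A: "A \<in> sets M" "emeasure M A = ennreal m" and m: "0 \<le> m" and t: "0 < t"
  shows "max_rearr M (indicator A) t \<le> ennreal (min 1 (m / t))"
proof -
  let ?I = "\<integral>\<^sup>+ s \<in> {0<..<t}. decr_rearr M (indicator A) s \<partial>lborel"
  have "?I \<le> (\<integral>\<^sup>+ s. indicator {0..t} s \<partial>lborel)"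
    using decr_rearr_indicator_le_1[OF A(1)]
    by (intro nn_integral_mono) (auto simp: indicator_def)
  then have "?I \<le> ennreal t"
    using t by simp
  moreover have "?I \<le> (\<integral>\<^sup>+ s. indicator {0..m} s \<partial>lborel)"
    using decr_rearr_indicator_le_1[OF A(1)] decr_rearr_indicator_eq_0[OF A(1)] A(2) m
    by (intro nn_integral_mono) (auto simp: indicator_def ennreal_le_iff2)
  then have "?I \<le> ennreal m"
    using m by simp
  ultimately have "?I \<le> ennreal (min t m)"
    by (auto simp: min_def)
  then have "max_rearr M (indicator A) t \<le> ennreal (1 / t) * ennreal (min t m)"
    unfolding max_rearr_def by (intro mult_left_mono) auto
  also have "\<dots> = ennreal (min 1 (m / t))"
    using t m by (subst ennreal_mult[symmetric]) (auto simp: min_def field_simps)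
  finally show ?thesis .
qed

text \<open>Of the two bounds in \<open>min 1 (m / t)\<close>, the first serves near 0 and the
  second near infinity. Cutting at 1 instead of at \<open>m\<close> keeps the domains of integration
  independent of \<open>A\<close>.\<close>

lemma weighted_max_rearr_indicator_le:
  assumes A: "A \<in> sets M" "emeasure M A = ennreal m" and m: "0 \<le> m" and t: "0 < t"
  shows "ennreal (t powr a) * max_rearr M (indicator A) t
    \<le> ennreal (if t \<le> 1 then t powr a else m * t powr (a - 1))"
proof -
  have "ennreal (t powr a) * max_rearr M (indicator A) t \<le> ennreal (t powr a) * ennreal (min 1 (m / t))"
    by (intro mult_left_mono max_rearr_indicator_le assms) auto
  also have "\<dots> = ennreal (t powr a * min 1 (m / t))"
    using t m by (subst ennreal_mult) auto
  also have "\<dots> \<le> ennreal (if t \<le> 1 then t powr a else m * t powr (a - 1))"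
  proof (intro ennreal_leI)
    have "t powr a * min 1 (m / t) \<le> t powr a * 1"
      by (intro mult_left_mono) auto
    moreover have "t powr a * min 1 (m / t) \<le> t powr a * (m / t)"
      by (intro mult_left_mono) auto
    moreover have "t powr a * (m / t) = m * t powr (a - 1)"
      using t by (simp add: powr_diff)
    ultimately show "t powr a * min 1 (m / t) \<le> (if t \<le> 1 then t powr a else m * t powr (a - 1))"
      by auto
  qed
  finally show ?thesis .
qed

text \<open>A power of \<open>t\<close> is integrable at 0 when its exponent exceeds -1, and at
  infinity when it is below -1; this is what \<open>0 < b\<close> and \<open>0 < c\<close>
  say.\<close>

lemma nn_integral_two_powers_finite:
  fixes b c K :: real
  assumes "0 < b" "0 < c" "0 \<le> K"
  shows "(\<integral>\<^sup>+ t. indicator {0..1} t * ennreal (t powr (b - 1))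
    + indicator {1..} t * ennreal (K * t powr (- c - 1)) \<partial>lborel) < \<infinity>"
proof -
  have 1: "((\<lambda>t. t powr (b - 1)) has_integral (1 powr (b - 1 + 1) / (b - 1 + 1))) {0..1}"
    using assms by (intro has_integral_powr_from_0) auto
  have 2: "((\<lambda>t. K * t powr (- c - 1)) has_integral
      K * (- (1 powr (- c - 1 + 1) / (- c - 1 + 1)))) {1..}"
    using assms has_integral_powr_to_inf[of "- c - 1" 1]
    by (intro has_integral_mult_right) auto
  show ?thesis
    using nn_integral_has_integral_lebesgue[OF _ 1] nn_integral_has_integral_lebesgue[OF _ 2] assms
    by (subst nn_integral_add) (auto simp: indicator_mult_ennreal)
qed

text \<open>With \<open>a = 1/p\<close>, the weighted maximal function is dominated by
  \<open>t powr a\<close> near 0 and by a multiple of \<open>t powr (a - 1)\<close> near infinity.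
  This is bounded for \<open>0 \<le> a < 1\<close>, and its \<open>q\<close>-th power is integrable
  against \<open>dt/t\<close> for \<open>0 < a < 1\<close>.\<close>

lemma indicator_in_lorentz_fun:
  assumes pq: "(1 < p \<and> p < \<infinity> \<and> 1 \<le> q \<and> q < \<infinity>) \<or> (1 < p \<and> q = \<infinity>)"
    and A: "A \<in> sets M" "emeasure M A < \<infinity>"
  shows "indicator A \<in> lorentz_fun M p q"
proof -
  obtain m where m: "emeasure M A = ennreal m" "0 \<le> m"
    using A(2) by (cases "emeasure M A") auto
  define a where "a = enn2real (1 / p)"
  note bound = weighted_max_rearr_indicator_le[OF A(1) m, of _ a]
  \<comment> \<open>For \<open>p = \<infinity>\<close> the exponent is 0; this occurs only with
    \<open>q = \<infinity>\<close>, where a supremum is taken and no integrability at 0 is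
    required.\<close>
  have a: "0 \<le> a" "a < 1" "p < \<infinity> \<Longrightarrow> 0 < a"
  proof -
    show "0 \<le> a" by (simp add: a_def)
    have "a < 1 \<and> (p < \<infinity> \<longrightarrow> 0 < a)"
    proof (cases p)
      case (real r)
      then have "1 < r" using pq by (auto simp: ennreal_less_iff simp flip: ennreal_1)
      moreover then have "a = 1 / r"
        unfolding a_def real by (subst ennreal_1[symmetric], subst divide_ennreal) auto
      ultimately show ?thesis by auto
    qed (auto simp: a_def)
    then show "a < 1" "p < \<infinity> \<Longrightarrow> 0 < a" by auto
  qed
  have "lorentz_norm M p q (indicator A) < \<infinity>"
  proof (cases "q = \<infinity>")
    case True
    have "ennreal (t powr a) * max_rearr M (indicator A) t \<le> ennreal (1 + m)" if "0 < t" for t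
    proof -
      have "(if t \<le> 1 then t powr a else m * t powr (a - 1)) \<le> 1 + m"
        using that a m powr_le1[of a t] powr_mono[of "a - 1" 0 t]
          mult_left_mono[of "t powr (a - 1)" 1 m] by auto
      then show ?thesis
        using bound[OF that] by (meson ennreal_leI order_trans)
    qed
    then have "lorentz_norm M p q (indicator A) \<le> ennreal (1 + m)"
      unfolding lorentz_norm_def a_def[symmetric] using True by (auto intro!: SUP_least)
    also have "\<dots> < \<infinity>" by simp
    finally show ?thesis .
  next
    case False
    then have fin: "1 < p" "p < \<infinity>" "1 \<le> q" "q < \<infinity>" using pq by auto
    then obtain r where r: "q = ennreal r" "1 \<le> r"
      by (cases q) (auto simp: ennreal_ge_1)
    have qr: "enn2real q = r" using r by simp
    let ?f = "\<lambda>t. enn_powr (ennreal (t powr a) * max_rearr M (indicator A) t) r * ennreal (1 / t)"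
    \<comment> \<open>The two summands are the \<open>r\<close>-th powers of the two branches of the
      bound, each divided by \<open>t\<close>. Both are present at \<open>t = 1\<close>, which is
      harmless for an upper bound.\<close>
    let ?g = "\<lambda>t. indicator {0..1} t * ennreal (t powr (a * r - 1))
      + indicator {1..} t * ennreal (m powr r * t powr (- ((1 - a) * r) - 1))"
    have "(\<integral>\<^sup>+ t \<in> {0<..}. ?f t \<partial>lborel) \<le> (\<integral>\<^sup>+ t. ?g t \<partial>lborel)"
    proof (intro nn_integral_mono)
      fix t :: real
      show "?f t * indicator {0<..} t \<le> ?g t"
      proof (cases "0 < t")
        case True
        let ?h = "if t \<le> 1 then t powr a else m * t powr (a - 1)"
        have h: "0 \<le> ?h" using m by simp
        have "?f t \<le> enn_powr (ennreal ?h) r * ennreal (1 / t)"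
          using r by (intro mult_right_mono enn_powr_mono bound True) auto
        also have "\<dots> = ennreal (?h powr r / t)"
          using True h by (simp add: enn_powr_def ennreal_mult[symmetric] del: ennreal_eq_0_iff)
        also have "?h powr r / t =
            (if t \<le> 1 then t powr (a * r - 1) else m powr r * t powr (- ((1 - a) * r) - 1))"
        proof -
          have "- ((1 - a) * r) = (a - 1) * r" by (simp add: algebra_simps)
          moreover have "t powr x / t = t powr (x - 1)" for x
            using True by (simp add: powr_diff)
          ultimately show ?thesis
            using True m by (simp add: powr_mult powr_powr flip: times_divide_eq_right)
        qed
        also have "ennreal \<dots> \<le> ?g t"
          using True by (auto simp: indicator_def)
        finally show ?thesis using True by simp
      qed simp
    qed
    \<comment> \<open>Here \<open>b = a * r\<close> is positive because \<open>p\<close> is finite,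
      and \<open>c = (1 - a) * r\<close> is positive because \<open>p > 1\<close>.\<close>
    also have "\<dots> < \<infinity>"
      using a fin r by (intro nn_integral_two_powers_finite) auto
    finally have "(\<integral>\<^sup>+ t \<in> {0<..}. ?f t \<partial>lborel) < \<infinity>" .
    moreover have "q / p < \<infinity>"
      using fin by (auto simp: ennreal_divide_eq_top_iff less_top[symmetric])
    ultimately have "q / p * (\<integral>\<^sup>+ t \<in> {0<..}. ?f t \<partial>lborel) < \<infinity>"
      by (simp add: ennreal_mult_less_top)
    then have "enn_powr (q / p * (\<integral>\<^sup>+ t \<in> {0<..}. ?f t \<partial>lborel)) (enn2real (1 / q)) < \<infinity>"
      by (rule enn_powr_finite)
    then show ?thesis
      unfolding lorentz_norm_def a_def[symmetric] qr using False by simp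
  qed
  then show ?thesis
    using A by (simp add: lorentz_fun_def)
qed

section \<open>Null spaces of powers on a.e.-classes\<close>

lemma lorentz_class_eq_zero_iff:
  assumes "f \<in> lorentz_fun M p q"
  shows "lorentz_class M p q f = lorentz_class M p q (\<lambda>_. 0) \<longleftrightarrow> (AE x in M. f x = 0)"
  unfolding lorentz_class_def
  by (subst eq_equiv_class_iff[OF equiv_lorentz_rel assms zero_in_lorentz_fun])
    (simp add: lorentz_rel_def assms zero_in_lorentz_fun)

lemma funpow_lorentz_fun:
  assumes "lorentz_bounded_op M p q L" "f \<in> lorentz_fun M p q"
  shows "(L ^^ k) f \<in> lorentz_fun M p q"
  using assms by (induction k) (auto simp: lorentz_bounded_op_def)

lemma funpow_lorentz_lift_class:
  assumes "lorentz_bounded_op M p q L" "f \<in> lorentz_fun M p q"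
  shows "(lorentz_lift M p q L ^^ k) (lorentz_class M p q f) = lorentz_class M p q ((L ^^ k) f)"
  by (induction k) (auto simp: lorentz_lift_class[OF assms(1) funpow_lorentz_fun[OF assms]])

text \<open>Lifting to classes commutes with iteration, so the question about classes reduces to one
  about a single representative.\<close>

lemma lorentz_class_in_null_space_iff:
  assumes "lorentz_bounded_op M p q L" "f \<in> lorentz_fun M p q"
  shows "lorentz_class M p q f \<in> null_space (lorentz_space M p q) (lorentz_class M p q (\<lambda>_. 0))
      (lorentz_lift M p q L ^^ k) \<longleftrightarrow> (AE x in M. (L ^^ k) f x = 0)"
proof -
  have "lorentz_class M p q f \<in> lorentz_space M p q"
    using assms(2) by (auto simp: lorentz_class_def lorentz_space_def intro: quotientI)
  then show ?thesis
    using lorentz_class_eq_zero_iff[OF funpow_lorentz_fun[OF assms]]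
    by (simp add: null_space_def funpow_lorentz_lift_class[OF assms])
qed

section \<open>Powers of the weighted composition operator\<close>

lemma funpow_weighted_comp:
  "(weighted_comp u T ^^ k) f x = (\<Prod>i=1..k. u ((T ^^ i) x)) * f ((T ^^ k) x)"
\<comment> \<open>The outermost application of the operator evaluates the \<open>k\<close>-th power
  at \<open>T x\<close>, so the induction hypothesis is needed at a point other than
  \<open>x\<close>. The factor \<open>i = 1\<close> splits off and the remaining indices shift by
  one.\<close>
proof (induction k arbitrary: x)
  case (Suc k)
  have "(\<Prod>i=1..Suc k. u ((T ^^ i) x)) = u (T x) * (\<Prod>i=1..k. u ((T ^^ i) (T x)))"
    by (subst prod.atLeast_Suc_atMost)
      (simp_all add: prod.shift_bounds_cl_Suc_ivl funpow_swap1 del: prod.cl_ivl_Suc)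
  then show ?case
    using Suc by (simp add: weighted_comp_def funpow_swap1 mult.assoc del: prod.cl_ivl_Suc)
qed simp

text \<open>By the product formula, the value at \<open>x\<close> is nonzero exactly when no factor
  \<open>u ((T ^^ i) x)\<close> vanishes and \<open>(T ^^ k) x\<close> lies in \<open>A\<close>. The
  measurability assumption makes this set measurable, so a.e. vanishing means that it has measure
  0.\<close>

lemma AE_funpow_weighted_comp_indicator_eq_0_iff:
  assumes "(weighted_comp u T ^^ k) (indicator A) \<in> borel_measurable M"
  shows "(AE x in M. (weighted_comp u T ^^ k) (indicator A) x = 0) \<longleftrightarrow>
    emeasure M (nonvanishing_set M u T k \<inter> ((T ^^ k) -` A \<inter> space M)) = 0"
proof -
  have "nonvanishing_set M u T k \<inter> ((T ^^ k) -` A \<inter> space M)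
      = {x \<in> space M. (weighted_comp u T ^^ k) (indicator A) x \<noteq> 0}"
    by (auto simp: nonvanishing_set_def funpow_weighted_comp indicator_def)
  moreover have "{x \<in> space M. (weighted_comp u T ^^ k) (indicator A) x \<noteq> 0} \<in> sets M"
    using assms by measurable
  ultimately show ?thesis
    by (intro AE_iff_measurable) auto
qed

theorem theorem4p13:
  fixes M :: "'a measure" and p q :: ennreal
    and T :: "'a \<Rightarrow> 'a" and u :: "'a \<Rightarrow> complex" and A :: "nat \<Rightarrow> 'a set"
  assumes "sigma_finite_measure M" and "complete_measure M"
    and "(1 < p \<and> p < \<infinity> \<and> 1 \<le> q \<and> q < \<infinity>) \<or> (1 < p \<and> q = \<infinity>)"
    and "T \<in> measurable M M" and "nonsingular M T"
    and "u \<in> borel_measurable M" and "\<not> (AE x in M. u x = 0)"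
    and "lorentz_bounded_op M p q (weighted_comp u T)"
    and "\<And>k. A k \<in> sets M"
    and "\<And>k. 0 < emeasure M (A k) \<and> emeasure M (A k) < \<infinity>"
    and "\<And>k. emeasure M (nonvanishing_set M u T k \<inter> ((T ^^ k) -` A k \<inter> space M)) \<noteq> 0"
    and "\<And>k. emeasure M (nonvanishing_set M u T (k + 1) \<inter> ((T ^^ (k + 1)) -` A k \<inter> space M)) = 0"
  shows "lorentz_ascent M p q (weighted_comp u T) = \<infinity>"
proof -
  let ?W = "weighted_comp u T"
  let ?N = "\<lambda>k. null_space (lorentz_space M p q) (lorentz_class M p q (\<lambda>_. 0))
    (lorentz_lift M p q ?W ^^ k)"
  have mem: "indicator (A k) \<in> lorentz_fun M p q" for k
    using assms(3,9,10) by (intro indicator_in_lorentz_fun) auto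
  \<comment> \<open>The power \<open>j\<close> and the index \<open>k\<close> of the set are kept
    separate, since both \<open>j = k\<close> and \<open>j = k + 1\<close> are needed. Measurability
    of the iterate is read off from its membership in \<open>lorentz_fun\<close>.\<close>
  have in_null: "lorentz_class M p q (indicator (A k)) \<in> ?N j \<longleftrightarrow>
      emeasure M (nonvanishing_set M u T j \<inter> ((T ^^ j) -` A k \<inter> space M)) = 0" for j k
    unfolding lorentz_class_in_null_space_iff[OF assms(8) mem]
    using funpow_lorentz_fun[OF assms(8) mem]
    by (intro AE_funpow_weighted_comp_indicator_eq_0_iff) (auto simp: lorentz_fun_def)
  \<comment> \<open>Condition (c) puts the class of the indicator into \<open>?N (k + 1)\<close>,
    and condition (b) keeps it out of \<open>?N k\<close>.\<close>
  have "?N (k + 1) \<noteq> ?N k" for k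
    using in_null[of k "k + 1"] in_null[of k k] assms(11,12)[of k] by blast
  \<comment> \<open>No \<open>k\<close> is admissible in the ascent, and the infimum of the empty
    set in \<open>enat\<close> is \<open>\<infinity>\<close>.\<close>
  then have "{enat k | k. ?N (k + 1) = ?N k} = {}" by blast
  then show ?thesis
    unfolding lorentz_ascent_def ascent_def by (simp only: Inf_enat_def) simp
qed

end
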